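(* Consider the family of hierarchical markets indexed by $M\in\{2,3,\dots\}$ described in the context, with benchmarked stock prices $\hat S^j$, $j\in\Gamma_M$, and volatility coefficients $\psi$. Assume that there is an adapted stochastic process $\sigma=\{\sigma_t,t\ge0\}$ and a finite constant $\bar\sigma^2$ with $E((\sigma_t)^2)\le\bar\sigma^2<\infty$ for all $t\in[0,\infty)$ such that, for all $M\in\{2,3,\dots\}$, all $h\in\{1,\dots,H\}$, all $k_1,\dots,k_h\in\{1,\dots,\bar KM\}$ and all $t\ge 0$, $$\sum_{j\in\Gamma_M}\left|\psi^{j,k_1,\dots,k_h}_t\right|\le(\bar KM)^{H-h}\,\sigma_t .$$ Let $(\hat V^{\pi_M})_{M\in\{2,3,\dots\}}$ be a sequence of benchmarked portfolios, where $\hat V^{\pi_M}$ has weights $\pi^j_{M,t}$, $j\in\Gamma_M$. Suppose that there are a parameter $\xi\in[0,\frac12)$ and a constant $C\in(0,\infty)$ such that for each $M\in\{2,3,\dots\}$ $$\max_{j\in\Gamma_M}|\pi^j_{M,t}|\le C\,M^{\xi-H}\qquad\text{for all }t\in[0,\infty).$$ Then $(\hat V^{\pi_M})_{M\in\{2,3,\dots\}}$ is a sequence of approximate benchmarked GP processes, i.e. for all $\varepsilon>0$ and $t\in[0,\infty)$, $$\lim_{M\to\infty}P\left(\frac{d[\hat Q^{\pi_M}]_t}{dt}>\varepsilon\right)=0 .$$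
   Context: **Benchmark.** The growth optimal portfolio (GP) of the market is the strictly positive self-financing portfolio maximizing the expected long-term growth rate $E\big(\frac1T\ln(V_T/V_0)\big)$ for all $T$. It is assumed to exist. "Benchmarked" means denominated in units of the GP. The GP, when benchmarked, is the constant $1$. **Hierarchical market.** Fix the number $H\in\{1,2,\dots\}$ of hierarchical levels and integers $0<\underline K\le\bar K<\infty$. For $M\in\{2,3,\dots\}$, each group of the hierarchy has at least $\underline KM$ and at most $\bar KM$ next-lower-level subgroups (the lowest-level constituents being stocks), so that there are between $(\underline KM)^H$ and $(\bar KM)^H$ stocks. Stocks are indexed by $j=(j_1,\dots,j_H)\in\Gamma_M=\{1,2,\dots,\bar KM\}^H$. Groups with fewer than $\bar KM$ subgroups are modeled by setting the respective volatility coefficients to zero. On a filtered probability space satisfying the usual conditions, let $W^{k_1,\dots,k_h}$, for $h\in\{1,\dots,H\}$ and $k_1,\dots,k_h\in\{1,\dots,\bar KM\}$, be independent standard Brownian motions. The benchmarked price $\hat S^j$ of the $j$-th stock satisfies $$\frac{d\hat S^j_t}{\hat S^j_t}=\sum_{h=1}^{H}\ \sum_{k_1=1}^{\bar KM}\cdots\sum_{k_h=1}^{\bar KM}\psi^{j,k_1,\dots,k_h}_t\,dW^{k_1,\dots,k_h}_t ,$$ with adapted volatility coefficients $\psi^{j,k_1,\dots,k_h}$. **Benchmarked portfolios.** A benchmarked portfolio $\hat V^{\pi_M}$ in the $M$-th market is a strictly positive self-financing portfolio, denominated in units of the GP, with adapted weights $\pi^j_{M,t}$ (the fraction of wealth invested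 in the $j$-th stock), $\sum_{j\in\Gamma_M}\pi^j_{M,t}=1$. Its return process $\hat Q^{\pi_M}$ satisfies $$d\hat Q^{\pi_M}_t=\frac{d\hat V^{\pi_M}_t}{\hat V^{\pi_M}_t}=\sum_{j\in\Gamma_M}\pi^j_{M,t}\frac{d\hat S^j_t}{\hat S^j_t},$$ and $[\hat Q^{\pi_M}]_t$ denotes its quadratic variation, whose time derivative is $$\frac{d[\hat Q^{\pi_M}]_t}{dt}=\sum_{h=1}^{H}\ \sum_{k_1=1}^{\bar KM}\cdots\sum_{k_h=1}^{\bar KM}\Big(\sum_{j\in\Gamma_M}\pi^j_{M,t}\,\psi^{j,k_1,\dots,k_h}_t\Big)^2 .$$ **Definition.** A sequence of benchmarked portfolios $(\hat V^{\pi_M})_{M\in\{2,3,\dots\}}$ with return processes $\hat Q^{\pi_M}$ is called a sequence of approximate benchmarked GP processes if for all $\varepsilon>0$ and $t\in[0,\infty)$, $\lim_{M\to\infty}P\big(\frac{d[\hat Q^{\pi_M}]_t}{dt}>\varepsilon\big)=0$. *)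

theory Defs
  imports "HOL-Probability.Probability"
begin

(* Processes have time index [0,\<infinity>); values at negative times are never used. *)
type_synonym 'a process = "real \<Rightarrow> 'a \<Rightarrow> real"


(* Filtered probability space satisfying the usual conditions. *)

locale filtered_prob_space = prob_space P for P :: "'a measure" +
  fixes F :: "real \<Rightarrow> 'a measure"
  assumes subalgebra_F: "0 \<le> t \<Longrightarrow> subalgebra P (F t)"
    and mono_F: "0 \<le> s \<Longrightarrow> s \<le> t \<Longrightarrow> sets (F s) \<subseteq> sets (F t)"
    and right_continuous_F: "0 \<le> t \<Longrightarrow> sets (F t) = (\<Inter>s\<in>{t<..}. sets (F s))"
    and complete_F: "A \<in> null_sets P \<Longrightarrow> B \<subseteq> A \<Longrightarrow> B \<in> sets (F 0)"

definition adapted :: "(real \<Rightarrow> 'a measure) \<Rightarrow> 'a process \<Rightarrow> bool" where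
  "adapted F X \<longleftrightarrow> (\<forall>t\<ge>0. X t \<in> borel_measurable (F t))"

definition converges_in_prob ::
    "'a measure \<Rightarrow> (nat \<Rightarrow> 'a \<Rightarrow> real) \<Rightarrow> ('a \<Rightarrow> real) \<Rightarrow> bool" where
  "converges_in_prob P X Y \<longleftrightarrow>
    (\<forall>\<epsilon>>0. (\<lambda>n. measure P {\<omega> \<in> space P. \<epsilon> < \<bar>X n \<omega> - Y \<omega>\<bar>}) \<longlonglongrightarrow> 0)"

definition brownian_motion ::
    "'a measure \<Rightarrow> (real \<Rightarrow> 'a measure) \<Rightarrow> 'a process \<Rightarrow> bool" where
  "brownian_motion P F W \<longleftrightarrow>
    adapted F W \<and>
    (AE \<omega> in P. W 0 \<omega> = 0 \<and> continuous_on {0..} (\<lambda>t. W t \<omega>)) \<and>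
    (\<forall>s t. 0 \<le> s \<and> s < t \<longrightarrow>
      distributed P lborel (\<lambda>\<omega>. W t \<omega> - W s \<omega>) (\<lambda>x. ennreal (normal_density 0 (sqrt (t - s)) x)) \<and>
      prob_space.indep_set P (sets (F s))
        (sets (vimage_algebra (space P) (\<lambda>\<omega>. W t \<omega> - W s \<omega>) borel)))"

(* Mutual independence of whole processes, viewed as random elements of the path space. *)
definition independent_processes :: "'a measure \<Rightarrow> 'k set \<Rightarrow> ('k \<Rightarrow> 'a process) \<Rightarrow> bool" where
  "independent_processes P I W \<longleftrightarrow>
    prob_space.indep_vars P (\<lambda>_. Pi\<^sub>M {0::real..} (\<lambda>_. borel))
      (\<lambda>k \<omega>. restrict (\<lambda>t. W k t \<omega>) {0..}) I"


(* Ito integral: the integrand is approximated, in the sense that the integral of the squared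
   error over each [0,t] tends to 0 in probability, by simple processes
   sum_{i<n} xi_i 1_{(tau_i, tau_(i+1)]} with xi_i bounded and F(tau_i)-measurable.
   The predicate says that I is a continuous adapted version of the integral of phi dW. *)

definition simple_integrand ::
    "'a measure \<Rightarrow> (real \<Rightarrow> 'a measure) \<Rightarrow> nat \<Rightarrow> (nat \<Rightarrow> real) \<Rightarrow> (nat \<Rightarrow> 'a \<Rightarrow> real) \<Rightarrow> bool" where
  "simple_integrand P F n \<tau> \<xi> \<longleftrightarrow>
    0 \<le> \<tau> 0 \<and> (\<forall>i<n. \<tau> i \<le> \<tau> (Suc i)) \<and>
    (\<forall>i<n. \<xi> i \<in> borel_measurable (F (\<tau> i)) \<and> (\<exists>c. \<forall>\<omega>\<in>space P. \<bar>\<xi> i \<omega>\<bar> \<le> c))"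

definition simple_process :: "nat \<Rightarrow> (nat \<Rightarrow> real) \<Rightarrow> (nat \<Rightarrow> 'a \<Rightarrow> real) \<Rightarrow> 'a process" where
  "simple_process n \<tau> \<xi> t \<omega> = (\<Sum>i<n. \<xi> i \<omega> * indicator {\<tau> i<..\<tau> (Suc i)} t)"

definition simple_integral ::
    "'a process \<Rightarrow> nat \<Rightarrow> (nat \<Rightarrow> real) \<Rightarrow> (nat \<Rightarrow> 'a \<Rightarrow> real) \<Rightarrow> 'a process" where
  "simple_integral W n \<tau> \<xi> t \<omega> =
    (\<Sum>i<n. \<xi> i \<omega> * (W (min t (\<tau> (Suc i))) \<omega> - W (min t (\<tau> i)) \<omega>))"

definition ito_integral ::
    "'a measure \<Rightarrow> (real \<Rightarrow> 'a measure) \<Rightarrow> 'a process \<Rightarrow> 'a process \<Rightarrow> 'a process \<Rightarrow> bool" where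
  "ito_integral P F W \<phi> I \<longleftrightarrow>
    adapted F \<phi> \<and>
    (\<lambda>(t, \<omega>). \<phi> t \<omega>) \<in> borel_measurable (restrict_space lborel {0..} \<Otimes>\<^sub>M P) \<and>
    adapted F I \<and>
    (AE \<omega> in P. continuous_on {0..} (\<lambda>t. I t \<omega>)) \<and>
    (\<exists>n \<tau> \<xi>. (\<forall>m. simple_integrand P F (n m) (\<tau> m) (\<xi> m)) \<and>
      (\<forall>t\<ge>0. \<forall>\<epsilon>>0. (\<lambda>m. measure P {\<omega> \<in> space P.
          ennreal \<epsilon> < (\<integral>\<^sup>+s\<in>{0..t}. ennreal ((simple_process (n m) (\<tau> m) (\<xi> m) s \<omega> - \<phi> s \<omega>)\<^sup>2) \<partial>lborel)})
          \<longlonglongrightarrow> 0) \<and>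
      (\<forall>t\<ge>0. converges_in_prob P (\<lambda>m. simple_integral W (n m) (\<tau> m) (\<xi> m) t) (I t)))"

(* dX = sum_{k in K} a^k dW^k *)
definition has_ito_differential ::
    "'a measure \<Rightarrow> (real \<Rightarrow> 'a measure) \<Rightarrow> 'k set \<Rightarrow> ('k \<Rightarrow> 'a process) \<Rightarrow>
     'a process \<Rightarrow> ('k \<Rightarrow> 'a process) \<Rightarrow> bool" where
  "has_ito_differential P F K W X a \<longleftrightarrow>
    adapted F X \<and>
    (\<exists>I. (\<forall>k\<in>K. ito_integral P F (W k) (a k) (I k)) \<and>
         (AE \<omega> in P. \<forall>t\<ge>0. X t \<omega> = X 0 \<omega> + (\<Sum>k\<in>K. I k t \<omega>)))"

(* X > 0 and dX / X = sum_{k in K} a^k dW^k *)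
definition has_relative_ito_differential ::
    "'a measure \<Rightarrow> (real \<Rightarrow> 'a measure) \<Rightarrow> 'k set \<Rightarrow> ('k \<Rightarrow> 'a process) \<Rightarrow>
     'a process \<Rightarrow> ('k \<Rightarrow> 'a process) \<Rightarrow> bool" where
  "has_relative_ito_differential P F K W X a \<longleftrightarrow>
    (AE \<omega> in P. \<forall>t\<ge>0. 0 < X t \<omega>) \<and>
    has_ito_differential P F K W X (\<lambda>k t \<omega>. X t \<omega> * a k t \<omega>)"

definition quadratic_variation ::
    "'a measure \<Rightarrow> (real \<Rightarrow> 'a measure) \<Rightarrow> 'a process \<Rightarrow> 'a process \<Rightarrow> bool" where
  "quadratic_variation P F X B \<longleftrightarrow>
    adapted F B \<and>
    (AE \<omega> in P. continuous_on {0..} (\<lambda>t. B t \<omega>)) \<and>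
    (\<forall>t\<ge>0. \<forall>n \<tau>.
      (\<forall>m. \<tau> m 0 = 0 \<and> \<tau> m (n m) = t \<and> (\<forall>i<n m. \<tau> m i \<le> \<tau> m (Suc i))) \<and>
      (\<forall>\<delta>>0. \<forall>\<^sub>F m in sequentially. \<forall>i<n m. \<tau> m (Suc i) - \<tau> m i < \<delta>) \<longrightarrow>
      converges_in_prob P (\<lambda>m \<omega>. \<Sum>i<n m. (X (\<tau> m (Suc i)) \<omega> - X (\<tau> m i) \<omega>)\<^sup>2) (B t))"

(* d[X]_t / dt = q_t, in integrated form: [X]_t is the integral of q over [0,t]. *)
definition qv_has_time_derivative ::
    "'a measure \<Rightarrow> (real \<Rightarrow> 'a measure) \<Rightarrow> 'a process \<Rightarrow> 'a process \<Rightarrow> bool" where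
  "qv_has_time_derivative P F X q \<longleftrightarrow>
    (\<exists>B. quadratic_variation P F X B \<and>
         (AE \<omega> in P. \<forall>t\<ge>0. ((\<lambda>s. q s \<omega>) has_integral B t \<omega>) {0..t}))"


(* Hierarchical index sets. A multi-index (k_1,...,k_h) in {1..K}^h is a list of length h. *)

definition multi_indices :: "nat \<Rightarrow> nat \<Rightarrow> nat list set" where
  "multi_indices K h = {k. length k = h \<and> set k \<subseteq> {1..K}}"

definition factor_indices :: "nat \<Rightarrow> nat \<Rightarrow> nat list set" where
  "factor_indices K H = (\<Union>h\<in>{1..H}. multi_indices K h)"

(* Groups of depth h that exist in the hierarchy, if the group with index g (a list; the whole
   market is the empty list) has subs g next-lower-level subgroups g @ [1], ..., g @ [subs g]. *)
definition existing_groups :: "(nat list \<Rightarrow> nat) \<Rightarrow> nat \<Rightarrow> nat list set" where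
  "existing_groups subs h = {g. length g = h \<and> (\<forall>i<h. g ! i \<in> {1..subs (take i g)})}"


(* Exposure of the portfolio with weights pi to the factor k. *)
definition exposure ::
    "nat list set \<Rightarrow> (nat list \<Rightarrow> nat list \<Rightarrow> 'a process) \<Rightarrow> (nat list \<Rightarrow> 'a process) \<Rightarrow>
     nat list \<Rightarrow> 'a process" where
  "exposure \<Gamma> \<psi> \<pi> k t \<omega> = (\<Sum>j\<in>\<Gamma>. \<pi> j t \<omega> * \<psi> j k t \<omega>)"

(* V > 0, weights sum to 1, and dV / V = sum_j pi^j dS^j / S^j
   = sum_k (sum_j pi^j psi^{j,k}) dW^k  (self-financing, in units of the GP). *)
definition benchmarked_portfolio ::
    "'a measure \<Rightarrow> (real \<Rightarrow> 'a measure) \<Rightarrow> nat \<Rightarrow> nat \<Rightarrow> (nat list \<Rightarrow> 'a process) \<Rightarrow>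
     (nat list \<Rightarrow> nat list \<Rightarrow> 'a process) \<Rightarrow> (nat list \<Rightarrow> 'a process) \<Rightarrow> 'a process \<Rightarrow> bool" where
  "benchmarked_portfolio P F K H W \<psi> \<pi> V \<longleftrightarrow>
    (\<forall>j\<in>multi_indices K H. adapted F (\<pi> j)) \<and>
    (\<forall>t\<ge>0. AE \<omega> in P. (\<Sum>j\<in>multi_indices K H. \<pi> j t \<omega>) = 1) \<and>
    has_relative_ito_differential P F (factor_indices K H) W V (exposure (multi_indices K H) \<psi> \<pi>)"

(* The time derivative of the quadratic variation of the return process. *)
definition qv_rate ::
    "nat \<Rightarrow> nat \<Rightarrow> (nat list \<Rightarrow> nat list \<Rightarrow> 'a process) \<Rightarrow> (nat list \<Rightarrow> 'a process) \<Rightarrow> 'a process" where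
  "qv_rate K H \<psi> \<pi> t \<omega> =
    (\<Sum>h=1..H. \<Sum>k\<in>multi_indices K h. (\<Sum>j\<in>multi_indices K H. \<pi> j t \<omega> * \<psi> j k t \<omega>)\<^sup>2)"

(* dQ = dV / V, with the stated time derivative of [Q]. That time derivative is a property of Ito
   integrals and does not restrict Q; it singles out the version of the Lebesgue density of [Q]
   which is meant by d[Q]_t / dt at an individual time t. *)
definition return_process ::
    "'a measure \<Rightarrow> (real \<Rightarrow> 'a measure) \<Rightarrow> nat \<Rightarrow> nat \<Rightarrow> (nat list \<Rightarrow> 'a process) \<Rightarrow>
     (nat list \<Rightarrow> nat list \<Rightarrow> 'a process) \<Rightarrow> (nat list \<Rightarrow> 'a process) \<Rightarrow> 'a process \<Rightarrow> bool" where
  "return_process P F K H W \<psi> \<pi> Q \<longleftrightarrow>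
    has_ito_differential P F (factor_indices K H) W Q (exposure (multi_indices K H) \<psi> \<pi>) \<and>
    qv_has_time_derivative P F Q (qv_rate K H \<psi> \<pi>)"

(* G is the value process of the GP in the original currency: a portfolio with benchmarked value V
   is worth V * G, and none has a larger expected growth rate than G over any horizon T.
   Portfolios whose log-return has no finite mean are not compared. *)
definition growth_optimal ::
    "'a measure \<Rightarrow> (real \<Rightarrow> 'a measure) \<Rightarrow> nat \<Rightarrow> nat \<Rightarrow> (nat list \<Rightarrow> 'a process) \<Rightarrow>
     (nat list \<Rightarrow> nat list \<Rightarrow> 'a process) \<Rightarrow> 'a process \<Rightarrow> bool" where
  "growth_optimal P F K H W \<psi> G \<longleftrightarrow>
    adapted F G \<and>
    (AE \<omega> in P. \<forall>t\<ge>0. 0 < G t \<omega>) \<and>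
    (\<forall>T>0. integrable P (\<lambda>\<omega>. ln (G T \<omega> / G 0 \<omega>))) \<and>
    (\<forall>\<pi> V. benchmarked_portfolio P F K H W \<psi> \<pi> V \<longrightarrow>
      (\<forall>T>0. integrable P (\<lambda>\<omega>. ln ((V T \<omega> * G T \<omega>) / (V 0 \<omega> * G 0 \<omega>))) \<longrightarrow>
        (\<integral>\<omega>. 1 / T * ln ((V T \<omega> * G T \<omega>) / (V 0 \<omega> * G 0 \<omega>)) \<partial>P)
          \<le> (\<integral>\<omega>. 1 / T * ln (G T \<omega> / G 0 \<omega>) \<partial>P)))"


(* The M-th hierarchical market; S is the family of benchmarked stock prices, so that stock j
   is worth S j * G in the original currency. *)
locale hierarchical_market = filtered_prob_space P F
  for P :: "'a measure" and F :: "real \<Rightarrow> 'a measure" +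
  fixes H Kmin Kmax M :: nat
    and subs :: "nat list \<Rightarrow> nat"
    and G :: "'a process"
    and W :: "nat list \<Rightarrow> 'a process"
    and S :: "nat list \<Rightarrow> 'a process"
    and \<psi> :: "nat list \<Rightarrow> nat list \<Rightarrow> 'a process"
  assumes H_ge_1: "1 \<le> H"
    and Kmin_pos: "0 < Kmin"
    and Kmin_le_Kmax: "Kmin \<le> Kmax"
    and M_ge_2: "2 \<le> M"
    and subgroups: "h < H \<Longrightarrow> g \<in> existing_groups subs h \<Longrightarrow> Kmin * M \<le> subs g \<and> subs g \<le> Kmax * M"
    and brownian: "k \<in> factor_indices (Kmax * M) H \<Longrightarrow> brownian_motion P F (W k)"
    and independent: "independent_processes P (factor_indices (Kmax * M) H) W"
    and vol_adapted: "j \<in> multi_indices (Kmax * M) H \<Longrightarrow> k \<in> factor_indices (Kmax * M) H \<Longrightarrow>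
      adapted F (\<psi> j k)"
    and vol_missing: "j \<in> multi_indices (Kmax * M) H - existing_groups subs H \<Longrightarrow>
      k \<in> factor_indices (Kmax * M) H \<Longrightarrow> 0 \<le> t \<Longrightarrow> \<omega> \<in> space P \<Longrightarrow> \<psi> j k t \<omega> = 0"
    and price: "j \<in> multi_indices (Kmax * M) H \<Longrightarrow>
      has_relative_ito_differential P F (factor_indices (Kmax * M) H) W (S j) (\<psi> j)"
    and GP: "growth_optimal P F (Kmax * M) H W \<psi> G"


(* q M is the time derivative of the quadratic variation of the M-th return process. *)
definition approximate_benchmarked_GPs :: "'a measure \<Rightarrow> (nat \<Rightarrow> 'a process) \<Rightarrow> bool" where
  "approximate_benchmarked_GPs P q \<longleftrightarrow>
    (\<forall>\<epsilon>>0. \<forall>t\<ge>0. (\<lambda>M. measure P {\<omega> \<in> space P. \<epsilon> < q M t \<omega>}) \<longlonglongrightarrow> 0)"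

end

(* A factor of depth h contributes at most (p s K^(H-h))^2 to the rate, where K = Kbar M, p bounds
   the weights and s = sigma_t; there are K^h such factors. So depth h contributes at most
   p^2 s^2 K^(2H-h), and h = 1 dominates. With p = C M^(xi-H) the rate is of order
   M^(2 xi - 1) s^2, and Markov's inequality concludes because xi < 1/2. *)

theory Submission
  imports Defs
begin

text \<open>Puts the conjuncts in the order used by the library facts on lists of fixed
  length.\<close>

lemma multi_indices_eq: "multi_indices K h = {k. set k \<subseteq> {1..K} \<and> length k = h}"
  by (auto simp: multi_indices_def)

lemma finite_multi_indices [simp]: "finite (multi_indices K h)"
  by (simp add: multi_indices_eq finite_lists_length_eq)

lemma card_multi_indices [simp]: "card (multi_indices K h) = K ^ h"
  by (simp add: multi_indices_eq card_lists_length_eq)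

text \<open>Hoelder's inequality with exponents infinity and 1: weights are controlled by their
  maximum, volatilities by their absolute sum.\<close>

lemma weighted_sum_square_le:
  fixes a b :: "'i \<Rightarrow> real"
  assumes "\<And>i. i \<in> A \<Longrightarrow> \<bar>a i\<bar> \<le> p" and "(\<Sum>i\<in>A. \<bar>b i\<bar>) \<le> B" and "0 \<le> p"
  shows "(\<Sum>i\<in>A. a i * b i)\<^sup>2 \<le> (p * B)\<^sup>2"
proof -
  have "\<bar>\<Sum>i\<in>A. a i * b i\<bar> \<le> (\<Sum>i\<in>A. \<bar>a i * b i\<bar>)"
    by (rule sum_abs)
  also have "\<dots> \<le> (\<Sum>i\<in>A. p * \<bar>b i\<bar>)"
    using assms(1) by (intro sum_mono) (simp add: abs_mult mult_right_mono)
  also have "\<dots> = p * (\<Sum>i\<in>A. \<bar>b i\<bar>)"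
    by (simp add: sum_distrib_left)
  also have "\<dots> \<le> p * B"
    using assms(2,3) by (rule mult_left_mono)
  finally show ?thesis
    by (metis abs_ge_zero power2_abs power_mono)
qed

text \<open>Deterministic, for a single t and \<omega>; it is applied almost surely later.\<close>

lemma qv_rate_le:
  assumes K: "1 \<le> K" and p: "0 \<le> p"
    and weights: "\<And>j. j \<in> multi_indices K H \<Longrightarrow> \<bar>\<pi> j t \<omega>\<bar> \<le> p"
    and vol: "\<And>h k. h \<in> {1..H} \<Longrightarrow> k \<in> multi_indices K h \<Longrightarrow>
      (\<Sum>j\<in>multi_indices K H. \<bar>\<psi> j k t \<omega>\<bar>) \<le> real K ^ (H - h) * s"
  shows "qv_rate K H \<psi> \<pi> t \<omega> \<le> real H * p\<^sup>2 * real K ^ (2 * H - 1) * s\<^sup>2"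
proof -
  have "qv_rate K H \<psi> \<pi> t \<omega> \<le> (\<Sum>h=1..H. \<Sum>k\<in>multi_indices K h. (p * (real K ^ (H - h) * s))\<^sup>2)"
    unfolding qv_rate_def using weights vol p by (intro sum_mono weighted_sum_square_le) auto
  also have "\<dots> = (\<Sum>h=1..H. p\<^sup>2 * s\<^sup>2 * real K ^ (2 * H - h))"
  proof (intro sum.cong refl)
    fix h assume "h \<in> {1..H}"
    \<comment> \<open>Of the exponent, h counts the factors of depth h and 2 * (H - h) comes from
      the squared volatility bound; truncated subtraction is safe as h \<le> H.\<close>
    then have "2 * H - h = h + 2 * (H - h)" by auto
    then have "real K ^ (2 * H - h) = real K ^ h * (real K ^ (H - h))\<^sup>2"
      by (metis power_add power_even_eq)
    then show "(\<Sum>k\<in>multi_indices K h. (p * (real K ^ (H - h) * s))\<^sup>2) = p\<^sup>2 * s\<^sup>2 * real K ^ (2 * H - h)"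
      by (simp add: power_mult_distrib)
  qed
  \<comment> \<open>Each of the H levels is bounded by the level h = 1, which is where the factor H
    comes from.\<close>
  also have "\<dots> \<le> (\<Sum>h=1..H. p\<^sup>2 * s\<^sup>2 * real K ^ (2 * H - 1))"
    using K by (intro sum_mono mult_left_mono power_increasing) auto
  finally show ?thesis
    by (simp add: mult_ac)
qed

theorem mainTheorem2:
  fixes P :: "'a measure" and F :: "real \<Rightarrow> 'a measure"
    and H Kmin Kmax :: nat
    and subs :: "nat \<Rightarrow> nat list \<Rightarrow> nat"
    and G :: "nat \<Rightarrow> 'a process"
    and W S :: "nat \<Rightarrow> nat list \<Rightarrow> 'a process"
    and \<psi> :: "nat \<Rightarrow> nat list \<Rightarrow> nat list \<Rightarrow> 'a process"
    and \<sigma> :: "'a process" and \<sigma>bar2 :: real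
    and \<pi> :: "nat \<Rightarrow> nat list \<Rightarrow> 'a process"
    and V Q :: "nat \<Rightarrow> 'a process"
    and \<xi> C :: real
  assumes market: "\<And>M. 2 \<le> M \<Longrightarrow>
      hierarchical_market P F H Kmin Kmax M (subs M) (G M) (W M) (S M) (\<psi> M)"
    and \<sigma>_adapted: "adapted F \<sigma>"
    and \<sigma>_second_moment: "\<And>t. 0 \<le> t \<Longrightarrow>
      integrable P (\<lambda>\<omega>. (\<sigma> t \<omega>)\<^sup>2) \<and> (\<integral>\<omega>. (\<sigma> t \<omega>)\<^sup>2 \<partial>P) \<le> \<sigma>bar2"
    and vol_bound: "\<And>M h k t. 2 \<le> M \<Longrightarrow> h \<in> {1..H} \<Longrightarrow> k \<in> multi_indices (Kmax * M) h \<Longrightarrow> 0 \<le> t \<Longrightarrow>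
      AE \<omega> in P. (\<Sum>j\<in>multi_indices (Kmax * M) H. \<bar>\<psi> M j k t \<omega>\<bar>)
        \<le> real (Kmax * M) ^ (H - h) * \<sigma> t \<omega>"
    and portfolio: "\<And>M. 2 \<le> M \<Longrightarrow> benchmarked_portfolio P F (Kmax * M) H (W M) (\<psi> M) (\<pi> M) (V M)"
    and return: "\<And>M. 2 \<le> M \<Longrightarrow> return_process P F (Kmax * M) H (W M) (\<psi> M) (\<pi> M) (Q M)"
    and \<xi>: "0 \<le> \<xi>" "\<xi> < 1 / 2"
    and C_pos: "0 < C"
    and weight_bound: "\<And>M t. 2 \<le> M \<Longrightarrow> 0 \<le> t \<Longrightarrow>
      AE \<omega> in P. Max ((\<lambda>j. \<bar>\<pi> M j t \<omega>\<bar>) ` multi_indices (Kmax * M) H) \<le> C * real M powr (\<xi> - real H)"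
  shows "approximate_benchmarked_GPs P (\<lambda>M. qv_rate (Kmax * M) H (\<psi> M) (\<pi> M))"
proof -
  \<comment> \<open>Any one market supplies the facts that do not depend on M: P is a probability
    space, \<open>Kmax\<close> and H are positive.\<close>
  interpret market_2: hierarchical_market P F H Kmin Kmax 2 "subs 2" "G 2" "W 2" "S 2" "\<psi> 2"
    using market by simp
  have Kmax_pos: "1 \<le> Kmax"
    using market_2.Kmin_pos market_2.Kmin_le_Kmax by simp
  have H_pos: "1 \<le> H"
    by (rule market_2.H_ge_1)
  \<comment> \<open>Collects what is independent of M in the bound of \<open>qv_rate_le\<close>;
    \<open>Kmax ^ (2 * H - 1)\<close> is split off from
    \<open>(Kmax * M) ^ (2 * H - 1)\<close>.\<close>
  define D where "D = real H * C\<^sup>2 * real Kmax ^ (2 * H - 1)"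
  have D_pos: "0 < D"
    using H_pos Kmax_pos C_pos by (simp add: D_def)
  have rate_bound: "AE \<omega> in P. qv_rate (Kmax * M) H (\<psi> M) (\<pi> M) t \<omega>
      \<le> D * real M powr (2 * \<xi> - 1) * (\<sigma> t \<omega>)\<^sup>2"
    if M: "2 \<le> M" and t: "0 \<le> t" for M t
  proof -
    let ?p = "C * real M powr (\<xi> - real H)"
    \<comment> \<open>The powers of H cancel. H \<ge> 1 makes the natural number 2 * H - 1 agree
      with its real counterpart.\<close>
    have "M powr (2 * (\<xi> - real H)) * M powr real (2 * H - 1) = M powr (2 * \<xi> - 1)"
      using H_pos by (simp add: powr_add [symmetric] of_nat_diff)
    then have rate: "real H * ?p\<^sup>2 * real (Kmax * M) ^ (2 * H - 1) = D * real M powr (2 * \<xi> - 1)"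
      using M by (simp add: D_def power_mult_distrib powr_realpow powr_power mult_ac)
    \<comment> \<open>The exceptional null set may depend on the factor; there are finitely many
      factors, so one null set serves all.\<close>
    have "AE \<omega> in P. \<forall>h\<in>{1..H}. \<forall>k\<in>multi_indices (Kmax * M) h.
        (\<Sum>j\<in>multi_indices (Kmax * M) H. \<bar>\<psi> M j k t \<omega>\<bar>) \<le> real (Kmax * M) ^ (H - h) * \<sigma> t \<omega>"
      using vol_bound M t by (intro AE_finite_allI) auto
    with weight_bound [OF M t] show ?thesis
    proof eventually_elim
      case (elim \<omega>)
      have "qv_rate (Kmax * M) H (\<psi> M) (\<pi> M) t \<omega>
          \<le> real H * ?p\<^sup>2 * real (Kmax * M) ^ (2 * H - 1) * (\<sigma> t \<omega>)\<^sup>2"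
      proof (rule qv_rate_le)
        fix j assume "j \<in> multi_indices (Kmax * M) H"
        then have "\<bar>\<pi> M j t \<omega>\<bar> \<le> Max ((\<lambda>j. \<bar>\<pi> M j t \<omega>\<bar>) ` multi_indices (Kmax * M) H)"
          by (intro Max_ge) auto
        with elim(1) show "\<bar>\<pi> M j t \<omega>\<bar> \<le> ?p"
          by linarith
      qed (use elim(2) M Kmax_pos C_pos in auto)
      then show ?case
        unfolding rate .
    qed
  qed
  show ?thesis
    unfolding approximate_benchmarked_GPs_def
  proof (intro allI impI)
    fix \<epsilon> t :: real assume \<epsilon>: "0 < \<epsilon>" and t: "0 \<le> t"
    let ?bad = "\<lambda>M. {\<omega> \<in> space P. \<epsilon> < qv_rate (Kmax * M) H (\<psi> M) (\<pi> M) t \<omega>}"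
    have int: "integrable P (\<lambda>\<omega>. (\<sigma> t \<omega>)\<^sup>2)" and moment: "(\<integral>\<omega>. (\<sigma> t \<omega>)\<^sup>2 \<partial>P) \<le> \<sigma>bar2"
      using \<sigma>_second_moment [OF t] by auto
    \<comment> \<open>Measurability with respect to P itself, for the event in Markov's
      inequality.\<close>
    note [measurable] = borel_measurable_integrable [OF int]
    have prob_bound: "measure P (?bad M) \<le> D * \<sigma>bar2 / \<epsilon> * real M powr (2 * \<xi> - 1)"
      if M: "2 \<le> M" for M
    proof -
      let ?b = "D * real M powr (2 * \<xi> - 1)"
      \<comment> \<open>Passing to a larger event stated through \<sigma> leaves only that event to
        be shown measurable; it has the non-strict form of Markov's inequality.\<close>
      have "measure P (?bad M) \<le> measure P {\<omega> \<in> space P. \<epsilon> \<le> ?b * (\<sigma> t \<omega>)\<^sup>2}"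
      proof (rule market_2.finite_measure_mono_AE)
        show "AE \<omega> in P. \<omega> \<in> ?bad M \<longrightarrow> \<omega> \<in> {\<omega> \<in> space P. \<epsilon> \<le> ?b * (\<sigma> t \<omega>)\<^sup>2}"
          using rate_bound [OF M t] by eventually_elim auto
      qed measurable
      also have "\<dots> \<le> (\<integral>\<omega>. ?b * (\<sigma> t \<omega>)\<^sup>2 \<partial>P) / \<epsilon>"
        \<comment> \<open>\<open>A\<close> is absent from the resulting inequality and so must be
          instantiated by hand, here with a trivially measurable set.\<close>
        using int \<epsilon> D_pos by (intro integral_Markov_inequality_measure [where A = "{}"]) auto
      also have "\<dots> = ?b / \<epsilon> * (\<integral>\<omega>. (\<sigma> t \<omega>)\<^sup>2 \<partial>P)"
        by simp
      also have "\<dots> \<le> ?b / \<epsilon> * \<sigma>bar2"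
        using moment D_pos \<epsilon> by (intro mult_left_mono) auto
      finally show ?thesis
        by (simp add: mult_ac)
    qed
    \<comment> \<open>This is where \<xi> < 1/2 enters: the exponent is negative.\<close>
    have "(\<lambda>M. real M powr (2 * \<xi> - 1)) \<longlonglongrightarrow> 0"
      using \<xi>(2) by (intro tendsto_neg_powr filterlim_real_sequentially) auto
    then have "(\<lambda>M. D * \<sigma>bar2 / \<epsilon> * real M powr (2 * \<xi> - 1)) \<longlonglongrightarrow> 0"
      by (rule tendsto_mult_right_zero)
    \<comment> \<open>The markets start at M = 2, so the bound is only claimed from there
      on.\<close>
    moreover have "\<forall>\<^sub>F M in sequentially. norm (measure P (?bad M)) \<le> D * \<sigma>bar2 / \<epsilon> * real M powr (2 * \<xi> - 1)"
      using prob_bound by (intro eventually_sequentiallyI [of 2]) simp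
    ultimately show "(\<lambda>M. measure P (?bad M)) \<longlonglongrightarrow> 0"
      by (rule Lim_null_comparison [rotated])
  qed
qed

end
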